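(* Let $g(z)=z+\sum_{n\ge 2}g_nz^n\in\mathbb{A}$, write $[n]_g=g_n$, let $\phi(z)=1+B_1z+B_2z^2+\cdots$ be as in the context, and let $\mu\in\mathbb{R}$. If $f(z)=z+\sum_{n\ge2}a_nz^n\in\mathbb{A}$ belongs to $\mathcal{C}_g(\phi)$, then $$|a_3-\mu a_2^2|\le\frac{B_1}{[3]_g([3]_g-1)}\begin{cases}-2\iota+1,&\mu\le\iota_1,\\ 1,&\iota_1\le\mu\le\iota_2,\\ 2\iota-1,&\mu\ge\iota_2,\end{cases}$$ where $$\iota=\frac12\left(1-\frac{B_2}{B_1}-\frac{B_1}{[2]_g-1}\left(1-\frac{[3]_g([3]_g-1)}{[2]_g^2([2]_g-1)}\mu\right)\right),$$ $$\iota_1=\frac{B_1^2[2]_g^2([2]_g-1)+(B_2-B_1)[2]_g^2([2]_g-1)^2}{B_1^2[3]_g([3]_g-1)},\qquad \iota_2=\frac{B_1^2[2]_g^2([2]_g-1)+(B_2+B_1)[2]_g^2([2]_g-1)^2}{B_1^2[3]_g([3]_g-1)}.$$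
   Context: $\mathbb{U}=\{z\in\mathbb{C}:|z|<1\}$, and $\mathbb{A}$ is the set of analytic functions $f$ on $\mathbb{U}$ with $f(0)=0$, $f'(0)=1$, i.e. $f(z)=z+\sum_{n\ge2}a_nz^n$. For analytic $F,\phi$ on $\mathbb{U}$, $F\prec\phi$ (subordination) means there is an analytic $u$ on $\mathbb{U}$ with $u(0)=0$, $|u(z)|<1$ and $F(z)=\phi(u(z))$ for all $z\in\mathbb{U}$. For $g(z)=z+\sum_{n\ge2}g_nz^n\in\mathbb{A}$, the $g$-derivative of $f\in\mathbb{A}$ is $D_gf(z)=\frac1z\left(z+\sum_{n\ge2}[n]_ga_nz^n\right)$, where $[n]_g=g_n$ (so $zD_gf\in\mathbb{A}$ is the convolution, i.e. Hadamard product, of $f$ and $g$). The function $\phi$ is analytic on $\mathbb{U}$ with positive real part, $\phi(0)=1$, $\phi'(0)>0$, $\phi(\mathbb{U})$ symmetric with respect to the real axis, with expansion $\phi(z)=1+B_1z+B_2z^2+B_3z^3+\cdots$, $B_1>0$. The class $\mathcal{C}_g(\phi)$ consists of all $f\in\mathbb{A}$ such that $\frac{D_g(zD_gf(z))}{D_gf(z)}\prec\phi(z)$.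
   Formalization: Assumes [2]_g, [3]_g, B_2 are real (so ι_1, ι_2 can be compared with μ), [2]_g ≠ 0, 1, and [3]_g([3]_g−1) > 0; if the last is negative, f(z)=z at μ=ι_1 violates the bound. *)

theory Defs
  imports "HOL-Complex_Analysis.Complex_Analysis"
begin

abbreviation unit_disc :: "complex set" where
  "unit_disc \<equiv> ball 0 1"

abbreviation tcoeff :: "(complex \<Rightarrow> complex) \<Rightarrow> nat \<Rightarrow> complex" where
  "tcoeff f n \<equiv> fps_nth (fps_expansion f 0) n"

definition class_A :: "(complex \<Rightarrow> complex) set" where
  "class_A = {f. f holomorphic_on unit_disc \<and> f 0 = 0 \<and> deriv f 0 = 1}"

definition subordinate :: "(complex \<Rightarrow> complex) \<Rightarrow> (complex \<Rightarrow> complex) \<Rightarrow> bool"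
    (infix "\<prec>\<^sub>s" 50) where
  "F \<prec>\<^sub>s \<phi> \<longleftrightarrow>
     F holomorphic_on unit_disc \<and> \<phi> holomorphic_on unit_disc \<and>
     (\<exists>u. u holomorphic_on unit_disc \<and> u 0 = 0 \<and>
          (\<forall>z\<in>unit_disc. norm (u z) < 1 \<and> F z = \<phi> (u z)))"

text \<open>
  The value at the removable singularity \<open>0\<close> is the constant coefficient \<open>1\<close>; it has to be given
  separately because \<open>x / 0 = 0\<close>.
\<close>
definition gderiv :: "(complex \<Rightarrow> complex) \<Rightarrow> (complex \<Rightarrow> complex) \<Rightarrow> complex \<Rightarrow> complex" where
  "gderiv g f z =
     (if z = 0 then 1
      else 1 / z * (z + (\<Sum>n. tcoeff g (n + 2) * tcoeff f (n + 2) * z ^ (n + 2))))"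

definition admissible_phi :: "(complex \<Rightarrow> complex) \<Rightarrow> bool" where
  "admissible_phi \<phi> \<longleftrightarrow>
     \<phi> holomorphic_on unit_disc \<and> (\<forall>z\<in>unit_disc. Re (\<phi> z) > 0) \<and>
     \<phi> 0 = 1 \<and> deriv \<phi> 0 \<in> \<real> \<and> Re (deriv \<phi> 0) > 0 \<and>
     cnj ` (\<phi> ` unit_disc) = \<phi> ` unit_disc"

text \<open>
  The quotient is taken pointwise.  For \<open>\<phi>\<close> with positive real part, subordination excludes the
  value \<open>0\<close>, so the denominator has no zeros in the disc even though \<open>x / 0 = 0\<close>.
\<close>
definition class_C :: "(complex \<Rightarrow> complex) \<Rightarrow> (complex \<Rightarrow> complex) \<Rightarrow> (complex \<Rightarrow> complex) set" where
  "class_C g \<phi> =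
     {f \<in> class_A. (\<lambda>z. gderiv g (\<lambda>w. w * gderiv g f w) z / gderiv g f z) \<prec>\<^sub>s \<phi>}"

end

theory Submission
  imports Defs
begin

text \<open>
  Membership in the class \<open>class_C g \<phi>\<close> provides a Schwarz function \<open>u(z) = u\<^sub>1 z + u\<^sub>2 z\<^sup>2 + \<dots>\<close>
  whose composition \<open>\<phi> \<circ> u\<close> is the quotient of two \<open>g\<close>-derivatives. Near \<open>0\<close> a \<open>g\<close>-derivative
  is the Hadamard product with \<open>g\<close>, divided by \<open>z\<close> (lemma \<open>gderiv_has_fps_expansion\<close>), so the
  numerator and the denominator are
    \<open>1 + g\<^sub>2\<^sup>2 a\<^sub>2 z + g\<^sub>3\<^sup>2 a\<^sub>3 z\<^sup>2 + \<dots>\<close> and \<open>1 + g\<^sub>2 a\<^sub>2 z + g\<^sub>3 a\<^sub>3 z\<^sup>2 + \<dots>\<close>.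
  Comparing coefficients (lemma \<open>class_C_coeffs\<close>) expresses \<open>a\<^sub>2\<close> and \<open>a\<^sub>3\<close> through \<open>u\<^sub>1\<close> and \<open>u\<^sub>2\<close>,
  and the Fekete-Szego functional becomes
    \<open>a\<^sub>3 - \<mu> a\<^sub>2\<^sup>2 = B\<^sub>1 / (g\<^sub>3 (g\<^sub>3 - 1)) \<cdot> (u\<^sub>2 + t u\<^sub>1\<^sup>2)\<close> with \<open>t = 1 - 2 \<iota>\<close>.

  For every Schwarz function \<open>\<bar>u\<^sub>2\<bar> \<le> 1 - \<bar>u\<^sub>1\<bar>\<^sup>2\<close>: this is the infinitesimal form of the
  Schwarz-Pick lemma at \<open>0\<close> for \<open>u(z) / z\<close>. Hence \<open>\<bar>u\<^sub>2 + t u\<^sub>1\<^sup>2\<bar>\<close> is at most a convex combination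
  of \<open>1\<close> and \<open>\<bar>t\<bar>\<close>, and so at most \<open>max 1 \<bar>t\<bar>\<close> (lemma \<open>schwarz_function_fekete_szego\<close>).
  The number \<open>t\<close> is a strictly decreasing affine function of \<open>\<mu>\<close>, equal to \<open>1\<close> at \<open>\<iota>1\<close> and to
  \<open>-1\<close> at \<open>\<iota>2\<close>; the three cases of the theorem are \<open>t \<ge> 1\<close>, \<open>-1 \<le> t \<le> 1\<close> and \<open>t \<le> -1\<close>.
\<close>

section \<open>Hadamard products and the \<open>g\<close>-derivative\<close>

definition fps_hadamard :: "'a::comm_semiring_1 fps \<Rightarrow> 'a fps \<Rightarrow> 'a fps" where
  "fps_hadamard F G = Abs_fps (\<lambda>n. fps_nth F n * fps_nth G n)"

lemma fps_hadamard_nth [simp]: "fps_nth (fps_hadamard F G) n = fps_nth F n * fps_nth G n"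
  by (simp add: fps_hadamard_def)

text \<open>
  If both series converge absolutely at \<open>r\<close>, the terms of the second one are eventually below \<open>1\<close>,
  so the product series is dominated at \<open>r\<^sup>2\<close> by the first series at \<open>r\<close>.
\<close>
lemma fps_conv_radius_hadamard_pos:
  fixes F G :: "complex fps"
  assumes "fps_conv_radius F > 0" "fps_conv_radius G > 0"
  shows "fps_conv_radius (fps_hadamard F G) > 0"
proof -
  obtain r where "0 < ereal r" "ereal r < min (fps_conv_radius F) (fps_conv_radius G)"
    using assms ereal_dense2[of 0 "min (fps_conv_radius F) (fps_conv_radius G)"] by auto
  then have r: "r > 0" "ereal r < fps_conv_radius F" "ereal r < fps_conv_radius G"
    by auto
  let ?z = "of_real r :: complex"
  have F: "summable (\<lambda>n. norm (fps_nth F n * ?z ^ n))"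
    using r by (intro norm_summable_fps) auto
  have G: "summable (\<lambda>n. norm (fps_nth G n * ?z ^ n))"
    using r by (intro norm_summable_fps) auto
  have "eventually (\<lambda>n. norm (fps_nth G n * ?z ^ n) < 1) sequentially"
    using summable_LIMSEQ_zero[OF G] by (rule order_tendstoD) simp
  then have "eventually (\<lambda>n. norm (fps_nth (fps_hadamard F G) n * (?z\<^sup>2) ^ n)
      \<le> norm (fps_nth F n * ?z ^ n)) sequentially"
  proof eventually_elim
    case (elim n)
    have "norm (fps_nth (fps_hadamard F G) n * (?z\<^sup>2) ^ n)
        = norm (fps_nth F n * ?z ^ n) * norm (fps_nth G n * ?z ^ n)"
      by (simp add: norm_mult norm_power power2_eq_square power_mult_distrib)
    also have "\<dots> \<le> norm (fps_nth F n * ?z ^ n) * 1"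
      using elim by (intro mult_left_mono) auto
    finally show ?case by simp
  qed
  then have "summable (\<lambda>n. fps_nth (fps_hadamard F G) n * (?z\<^sup>2) ^ n)"
    using F by (rule summable_comparison_test_ev)
  then have "ereal (norm (?z\<^sup>2)) \<le> fps_conv_radius (fps_hadamard F G)"
    unfolding fps_conv_radius_def by (rule conv_radius_geI)
  moreover have "0 < ereal (norm (?z\<^sup>2))"
    using r by (simp add: norm_power)
  ultimately show ?thesis by (rule less_le_trans[rotated])
qed

lemma has_fps_expansion_eventually_eq:
  assumes "f has_fps_expansion F" "eventually (\<lambda>z. f z = g z) (nhds 0)"
  shows "g has_fps_expansion F"
  using has_fps_expansion_cong[OF assms(2) refl] assms(1) by simp

text \<open>
  Only the germs of \<open>f\<close> and \<open>g\<close> at \<open>0\<close> enter, so that the lemma can be applied a second time to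
  \<open>w * gderiv g f w\<close>, without a proof that it is analytic in the whole disc.
  The normalisation makes the Hadamard product start with \<open>z\<close>, in agreement with the term \<open>z\<close> and the
  value \<open>1\<close> at \<open>0\<close> that the definition of the \<open>g\<close>-derivative prescribes.
\<close>
lemma gderiv_has_fps_expansion:
  assumes f: "f has_fps_expansion F" "fps_nth F 0 = 0" "fps_nth F 1 = 1"
    and g: "g has_fps_expansion G" "fps_nth G 1 = 1"
  shows "gderiv g f has_fps_expansion fps_shift 1 (fps_hadamard G F)"
proof -
  define P where "P = fps_hadamard G F"
  have P0: "fps_nth P 0 = 0" and P1: "fps_nth P 1 = 1"
    using f g by (simp_all add: P_def)
  have rad: "fps_conv_radius P > 0"
    using f(1) g(1) unfolding P_def
    by (intro fps_conv_radius_hadamard_pos) (auto simp: has_fps_expansion_def)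
  have P: "eval_fps P has_fps_expansion P"
    using rad by (auto simp: has_fps_expansion_def)
  have sub: "1 \<le> subdegree P"
    using P0 P1 by (metis fps_nonzeroI less_one not_le subdegree_eq_0_iff zero_neq_one)
  have exp: "(\<lambda>z. if z = 0 then 1 else eval_fps P z / z ^ 1) has_fps_expansion fps_shift 1 P"
    using has_fps_expansion_shift[OF P sub P1[symmetric]] .
  have coeffs: "fps_expansion f 0 = F" "fps_expansion g 0 = G"
    using f(1) g(1) by (simp_all add: fps_expansion_eqI)
  have "eventually (\<lambda>z::complex. z \<in> eball 0 (fps_conv_radius P)) (nhds 0)"
    using rad by (intro eventually_nhds_in_open) (auto simp: zero_ereal_def)
  then have "eventually (\<lambda>z. (if z = 0 then 1 else eval_fps P z / z ^ 1) = gderiv g f z) (nhds 0)"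
  proof eventually_elim
    case (elim z)
    then have "summable (\<lambda>n. fps_nth P n * z ^ n)"
      by (intro summable_fps) (simp add: in_eball_iff)
    from suminf_split_initial_segment[OF this, of 2]
    have "eval_fps P z = z + (\<Sum>n. fps_nth P (n + 2) * z ^ (n + 2))"
      using P0 P1 by (simp add: eval_fps_def numeral_2_eq_2)
    then show ?case
      by (simp add: gderiv_def coeffs P_def)
  qed
  then show ?thesis
    using has_fps_expansion_eventually_eq[OF exp] by (simp add: P_def)
qed

section \<open>Coefficients of Schwarz functions\<close>

text \<open>
  The Moebius transformation \<open>M\<close> that moves \<open>f 0\<close> to \<open>0\<close> turns \<open>f\<close> into a function to which the
  Schwarz lemma applies. The chain rule, with \<open>M' (f 0) = 1 / (1 - \<bar>f 0\<bar>\<^sup>2)\<close>, translates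
  \<open>\<bar>(M \<circ> f)' 0\<bar> \<le> 1\<close> back into a bound for \<open>f\<close>.
\<close>
lemma schwarz_pick_at_0:
  assumes holf: "f holomorphic_on ball 0 1"
    and bound: "\<And>z. norm z < 1 \<Longrightarrow> norm (f z) < 1"
  shows "norm (deriv f 0) \<le> 1 - (norm (f 0))\<^sup>2"
proof -
  define w where "w = f 0"
  have w: "norm w < 1" using bound[of 0] by (simp add: w_def)
  define M where "M = Moebius_function 0 w"
  have hol: "(M \<circ> f) holomorphic_on ball 0 1"
    unfolding M_def
    by (rule holomorphic_on_compose_gen[OF holf Moebius_function_holomorphic[OF w]])
      (use bound in auto)
  have le1: "norm (deriv (M \<circ> f) 0) \<le> 1"
  proof (rule Schwarz_Lemma(2)[OF hol, of 0])
    show "(M \<circ> f) 0 = 0" by (simp add: M_def w_def Moebius_function_eq_zero)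
    show "norm ((M \<circ> f) z) < 1" if "norm z < 1" for z
      using Moebius_function_norm_lt_1[OF w bound[OF that]] by (simp add: M_def)
  qed simp
  define s where "s = 1 - (norm w)\<^sup>2"
  have s: "s > 0"
    using w by (simp add: s_def abs_square_less_1)
  have ws: "1 - cnj w * w = of_real s"
    using complex_norm_square[of w] by (simp add: s_def mult.commute)
  have "(f has_field_derivative deriv f 0) (at 0)"
    using holomorphic_derivI[OF holf] by simp
  \<comment> \<open>The unevaluated form of the quotient rule; its value at \<open>w\<close> is \<open>1 / s\<close>.\<close>
  moreover have "(M has_field_derivative
      ((1 - 0) * (1 - cnj w * w) - (w - w) * (0 - cnj w * 1)) / ((1 - cnj w * w) * (1 - cnj w * w))) (at w)"
    unfolding M_def Moebius_function_simple
    by (intro DERIV_divide DERIV_diff DERIV_const DERIV_ident DERIV_cmult) (use ws s in simp)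
  ultimately have "((M \<circ> f) has_field_derivative 1 / of_real s * deriv f 0) (at 0)"
    using s by (intro DERIV_chain) (simp_all add: ws flip: w_def)
  then have "deriv (M \<circ> f) 0 = 1 / of_real s * deriv f 0"
    by (rule DERIV_imp_deriv)
  then have "norm (deriv f 0) / s \<le> 1"
    using le1 s by (simp add: norm_divide norm_mult)
  then show ?thesis
    using s by (simp add: s_def w_def)
qed

text \<open>
  With \<open>u z = z * h z\<close>, the two coefficients are \<open>h 0\<close> and \<open>deriv h 0\<close>. The equality case of the
  Schwarz lemma says that either \<open>u\<close> is a rotation, where both sides vanish, or \<open>h\<close> maps the disc
  into the open disc, where the Schwarz-Pick bound applies to \<open>h\<close>.
\<close>
lemma schwarz_function_coeff_bound:
  assumes hol: "u holomorphic_on ball 0 1" and u0: "u 0 = 0"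
    and bound: "\<And>z. norm z < 1 \<Longrightarrow> norm (u z) < 1"
  shows "norm (tcoeff u 2) \<le> 1 - (norm (tcoeff u 1))\<^sup>2"
proof -
  obtain h where h: "h holomorphic_on ball 0 1"
    and uh: "\<And>z. norm z < 1 \<Longrightarrow> u z = z * h z" and "deriv u 0 = h 0"
    using Schwarz3[OF hol u0] by metis
  define H where "H = fps_expansion h 0"
  have hH: "h has_fps_expansion H"
    unfolding H_def by (rule has_fps_expansion_fps_expansion[OF _ _ h]) auto
  have "(\<lambda>z. z * h z) has_fps_expansion fps_X * H"
    by (intro fps_expansion_intros hH)
  moreover have "eventually (\<lambda>z. z * h z = u z) (nhds 0)"
    using eventually_nhds_in_open[of "ball 0 1" "0::complex"]
    by (auto elim!: eventually_mono simp: uh)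
  ultimately have "u has_fps_expansion fps_X * H"
    by (rule has_fps_expansion_eventually_eq)
  then have U: "fps_expansion u 0 = fps_X * H"
    by (rule fps_expansion_eqI)
  have H0: "fps_nth H 0 = h 0" and H1: "fps_nth H 1 = deriv h 0"
    by (simp_all add: H_def fps_expansion_def)
  have u1: "tcoeff u 1 = h 0" and u2: "tcoeff u 2 = deriv h 0"
    using H0 H1 by (simp_all add: U numeral_2_eq_2)
  have du: "deriv u 0 = tcoeff u 1"
    by (simp add: fps_expansion_def)
  show ?thesis
  proof (cases "(\<exists>z. norm z < 1 \<and> z \<noteq> 0 \<and> norm (u z) = norm z) \<or> norm (deriv u 0) = 1")
    case True
    then obtain \<alpha> where \<alpha>: "\<And>z. norm z < 1 \<Longrightarrow> u z = \<alpha> * z" "norm \<alpha> = 1"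
      using Schwarz_Lemma(3)[OF hol u0 bound, of 0] by auto
    have "(\<lambda>z. \<alpha> * z) has_fps_expansion fps_const \<alpha> * fps_X"
      by (intro fps_expansion_intros)
    moreover have "eventually (\<lambda>z. \<alpha> * z = u z) (nhds 0)"
      using eventually_nhds_in_open[of "ball 0 1" "0::complex"]
      by (auto elim!: eventually_mono simp: \<alpha>(1))
    ultimately have "u has_fps_expansion fps_const \<alpha> * fps_X"
      by (rule has_fps_expansion_eventually_eq)
    then have "fps_expansion u 0 = fps_const \<alpha> * fps_X"
      by (rule fps_expansion_eqI)
    then show ?thesis by (simp add: \<alpha>(2) numeral_2_eq_2)
  next
    case False
    have "norm (h z) < 1" if z: "norm z < 1" for z
    proof (cases "z = 0")
      case True
      have "norm (deriv u 0) \<le> 1"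
        by (rule Schwarz_Lemma(2)[OF hol u0 bound, of 0]) auto
      then show ?thesis
        using False True du u1 z by force
    next
      case nz: False
      have "norm (u z) \<le> norm z"
        by (rule Schwarz_Lemma(1)[OF hol u0 bound z])
      then have "norm (u z) < norm z"
        using False z nz by force
      then show ?thesis
        using nz by (simp add: uh[OF z] norm_mult)
    qed
    from schwarz_pick_at_0[OF h this] show ?thesis
      by (simp only: u1 u2)
  qed
qed

text \<open>
  With \<open>x = \<bar>u\<^sub>1\<bar>\<^sup>2\<close>, the triangle inequality and the preceding bound leave the convex combination
  \<open>(1 - x) + x \<bar>t\<bar>\<close>.
\<close>
lemma schwarz_function_fekete_szego:
  fixes t :: real
  assumes "u holomorphic_on ball 0 1" "u 0 = 0"
    and "\<And>z. norm z < 1 \<Longrightarrow> norm (u z) < 1"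
  shows "norm (tcoeff u 2 + of_real t * (tcoeff u 1)\<^sup>2) \<le> max 1 \<bar>t\<bar>"
proof -
  define x where "x = (norm (tcoeff u 1))\<^sup>2"
  have u2: "norm (tcoeff u 2) \<le> 1 - x"
    using schwarz_function_coeff_bound[OF assms] by (simp add: x_def)
  then have x: "0 \<le> x" "x \<le> 1"
    using norm_ge_zero[of "tcoeff u 2"] by (auto simp: x_def simp del: norm_ge_zero)
  have "norm (tcoeff u 2 + of_real t * (tcoeff u 1)\<^sup>2)
      \<le> norm (tcoeff u 2) + norm (of_real t * (tcoeff u 1)\<^sup>2)"
    by (rule norm_triangle_ineq)
  also have "norm (of_real t * (tcoeff u 1)\<^sup>2) = \<bar>t\<bar> * x"
    by (simp add: norm_mult norm_power x_def)
  also have "norm (tcoeff u 2) + \<bar>t\<bar> * x \<le> (1 - x) * max 1 \<bar>t\<bar> + x * max 1 \<bar>t\<bar>"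
  proof (rule add_mono)
    have "(1 - x) * 1 \<le> (1 - x) * max 1 \<bar>t\<bar>"
      using x by (intro mult_left_mono) auto
    then show "norm (tcoeff u 2) \<le> (1 - x) * max 1 \<bar>t\<bar>"
      using u2 by simp
    show "\<bar>t\<bar> * x \<le> x * max 1 \<bar>t\<bar>"
      using x by (subst mult.commute) (intro mult_left_mono, auto)
  qed
  finally show ?thesis by (simp add: algebra_simps)
qed

section \<open>The Fekete-Szego inequality\<close>

text \<open>
  With \<open>D\<close> and \<open>E\<close> the power series of the inner and the outer \<open>g\<close>-derivative, subordination becomes
  the formal identity \<open>E = D * (\<Phi> oo U)\<close>. The two equations are its coefficients at \<open>z\<close> and \<open>z\<^sup>2\<close>;
  in the second, the first has been used to eliminate the mixed term.
\<close>
lemma class_C_coeffs: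
  assumes g: "g \<in> class_A" and f: "f \<in> class_C g \<phi>" and phi0: "\<phi> 0 = 1"
  obtains u where "u holomorphic_on ball 0 1" "u 0 = 0" "\<And>z. norm z < 1 \<Longrightarrow> norm (u z) < 1"
    "tcoeff g 2 * (tcoeff g 2 - 1) * tcoeff f 2 = tcoeff \<phi> 1 * tcoeff u 1"
    "tcoeff g 3 * (tcoeff g 3 - 1) * tcoeff f 3
      = tcoeff \<phi> 1 * tcoeff u 2 + tcoeff \<phi> 2 * (tcoeff u 1)\<^sup>2
        + (tcoeff g 2)\<^sup>2 * (tcoeff g 2 - 1) * (tcoeff f 2)\<^sup>2"
proof -
  define q where "q = (\<lambda>z. gderiv g (\<lambda>w. w * gderiv g f w) z / gderiv g f z)"
  have fA: "f \<in> class_A" and "q \<prec>\<^sub>s \<phi>"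
    using f by (auto simp: class_C_def q_def)
  then obtain u where hol\<phi>: "\<phi> holomorphic_on ball 0 1"
    and holu: "u holomorphic_on ball 0 1" and u0: "u 0 = 0"
    and bound: "\<And>z. norm z < 1 \<Longrightarrow> norm (u z) < 1"
    and q: "\<And>z. norm z < 1 \<Longrightarrow> q z = \<phi> (u z)"
    unfolding subordinate_def by (metis mem_ball_0)
  define F G \<Phi> U where "F = fps_expansion f 0" and "G = fps_expansion g 0"
    and "\<Phi> = fps_expansion \<phi> 0" and "U = fps_expansion u 0"
  note defs = F_def G_def \<Phi>_def U_def
  have expansion: "k has_fps_expansion fps_expansion k 0" if "k holomorphic_on ball 0 1" for k
    by (rule has_fps_expansion_fps_expansion[OF _ _ that]) auto
  have fF: "f has_fps_expansion F" and gG: "g has_fps_expansion G"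
    and \<phi>\<Phi>: "\<phi> has_fps_expansion \<Phi>" and uU: "u has_fps_expansion U"
    using fA g holu hol\<phi> by (auto simp: defs class_A_def intro: expansion)
  have F01: "fps_nth F 0 = 0" "fps_nth F 1 = 1" and G1: "fps_nth G 1 = 1"
    and U0: "fps_nth U 0 = 0" and \<Phi>0: "fps_nth \<Phi> 0 = 1"
    using fA g u0 phi0 by (simp_all add: defs class_A_def fps_expansion_def)
  define D E where "D = fps_shift 1 (fps_hadamard G F)"
    and "E = fps_shift 1 (fps_hadamard G (fps_X * D))"
  have D: "gderiv g f has_fps_expansion D"
    unfolding D_def by (rule gderiv_has_fps_expansion[OF fF F01 gG G1])
  have D0: "fps_nth D 0 = 1" using F01 G1 by (simp add: D_def)
  have zD: "(\<lambda>w. w * gderiv g f w) has_fps_expansion fps_X * D"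
    by (intro fps_expansion_intros D)
  have E: "gderiv g (\<lambda>w. w * gderiv g f w) has_fps_expansion E"
    unfolding E_def by (rule gderiv_has_fps_expansion[OF zD _ _ gG G1]) (simp_all add: D0)
  have "q has_fps_expansion E / D"
    unfolding q_def by (rule has_fps_expansion_divide'[OF E D]) (simp add: D0)
  moreover have "eventually (\<lambda>z. q z = (\<phi> \<circ> u) z) (nhds 0)"
    using eventually_nhds_in_open[of "ball 0 1" "0::complex"]
    by (auto elim!: eventually_mono simp: q)
  ultimately have "(\<phi> \<circ> u) has_fps_expansion E / D"
    by (rule has_fps_expansion_eventually_eq)
  moreover have "(\<phi> \<circ> u) has_fps_expansion (\<Phi> oo U)"
    by (rule has_fps_expansion_compose[OF \<phi>\<Phi> uU U0])
  ultimately have "E / D = \<Phi> oo U"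
    by (rule fps_expansion_unique_complex)
  moreover have "D dvd E"
    by (rule unit_imp_dvd) (simp add: D0)
  ultimately have ED: "E = D * (\<Phi> oo U)"
    by (metis dvd_mult_div_cancel)
  have comp1: "fps_nth (\<Phi> oo U) 1 = fps_nth \<Phi> 1 * fps_nth U 1"
    by (simp add: fps_compose_nth)
  have comp2: "fps_nth (\<Phi> oo U) 2 = fps_nth \<Phi> 1 * fps_nth U 2 + fps_nth \<Phi> 2 * (fps_nth U 1)\<^sup>2"
    using U0 by (simp add: fps_compose_nth numeral_2_eq_2 power2_eq_square fps_mult_nth)
  have Dn: "fps_nth D 1 = fps_nth G 2 * fps_nth F 2" "fps_nth D 2 = fps_nth G 3 * fps_nth F 3"
    and En: "fps_nth E 1 = (fps_nth G 2)\<^sup>2 * fps_nth F 2" "fps_nth E 2 = (fps_nth G 3)\<^sup>2 * fps_nth F 3"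
    by (simp_all add: D_def E_def numeral_2_eq_2 numeral_3_eq_3 power2_eq_square)
  have "fps_nth E 1 = fps_nth (\<Phi> oo U) 1 + fps_nth D 1"
    using D0 \<Phi>0 by (simp add: ED fps_mult_nth)
  then have c1: "fps_nth G 2 * (fps_nth G 2 - 1) * fps_nth F 2 = fps_nth \<Phi> 1 * fps_nth U 1"
    unfolding comp1 Dn En by (simp add: algebra_simps power2_eq_square)
  have "fps_nth E 2 = fps_nth (\<Phi> oo U) 2 + fps_nth D 1 * fps_nth (\<Phi> oo U) 1 + fps_nth D 2"
    using D0 \<Phi>0 by (simp add: ED fps_mult_nth numeral_2_eq_2)
  then have c2: "fps_nth G 3 * (fps_nth G 3 - 1) * fps_nth F 3
      = fps_nth \<Phi> 1 * fps_nth U 2 + fps_nth \<Phi> 2 * (fps_nth U 1)\<^sup>2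
        + (fps_nth G 2)\<^sup>2 * (fps_nth G 2 - 1) * (fps_nth F 2)\<^sup>2"
    unfolding comp1 comp2 Dn En c1[symmetric] by (simp add: algebra_simps power2_eq_square)
  show ?thesis
    by (rule that[OF holu u0 bound c1[unfolded defs] c2[unfolded defs]])
qed

theorem theorem3p7:
  fixes f g \<phi> :: "complex \<Rightarrow> complex"
    and \<mu> g2 g3 B1 B2 \<iota> \<iota>1 \<iota>2 :: real
  assumes g: "g \<in> class_A"
    and g2: "tcoeff g 2 = of_real g2" and g3: "tcoeff g 3 = of_real g3"
    and nondegenerate: "g2 \<noteq> 0" "g2 \<noteq> 1" "g3 * (g3 - 1) > 0"
    and phi: "admissible_phi \<phi>"
    and B1: "tcoeff \<phi> 1 = of_real B1" and B2: "tcoeff \<phi> 2 = of_real B2"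
    and f: "f \<in> class_C g \<phi>"
    and iota: "\<iota> = 1 / 2 * (1 - B2 / B1 - B1 / (g2 - 1) *
                 (1 - g3 * (g3 - 1) / (g2\<^sup>2 * (g2 - 1)) * \<mu>))"
    and iota1: "\<iota>1 = (B1\<^sup>2 * g2\<^sup>2 * (g2 - 1) + (B2 - B1) * g2\<^sup>2 * (g2 - 1)\<^sup>2) /
                  (B1\<^sup>2 * g3 * (g3 - 1))"
    and iota2: "\<iota>2 = (B1\<^sup>2 * g2\<^sup>2 * (g2 - 1) + (B2 + B1) * g2\<^sup>2 * (g2 - 1)\<^sup>2) /
                  (B1\<^sup>2 * g3 * (g3 - 1))"
  shows "(\<mu> \<le> \<iota>1 \<longrightarrow>
            norm (tcoeff f 3 - of_real \<mu> * (tcoeff f 2)\<^sup>2) \<le> B1 / (g3 * (g3 - 1)) * (- 2 * \<iota> + 1)) \<and>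
         (\<iota>1 \<le> \<mu> \<and> \<mu> \<le> \<iota>2 \<longrightarrow>
            norm (tcoeff f 3 - of_real \<mu> * (tcoeff f 2)\<^sup>2) \<le> B1 / (g3 * (g3 - 1)) * 1) \<and>
         (\<mu> \<ge> \<iota>2 \<longrightarrow>
            norm (tcoeff f 3 - of_real \<mu> * (tcoeff f 2)\<^sup>2) \<le> B1 / (g3 * (g3 - 1)) * (2 * \<iota> - 1))"
proof -
  have phi0: "\<phi> 0 = 1" and "Re (deriv \<phi> 0) > 0"
    using phi by (auto simp: admissible_phi_def)
  moreover have "deriv \<phi> 0 = of_real B1"
    using B1 by (simp add: fps_expansion_def)
  ultimately have B1_pos: "B1 > 0" by simp
  obtain u where u: "u holomorphic_on ball 0 1" "u 0 = 0" "\<And>z. norm z < 1 \<Longrightarrow> norm (u z) < 1"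
    and c1: "of_real (g2 * (g2 - 1)) * tcoeff f 2 = of_real B1 * tcoeff u 1"
    and c2: "of_real (g3 * (g3 - 1)) * tcoeff f 3
      = of_real B1 * tcoeff u 2 + of_real B2 * (tcoeff u 1)\<^sup>2
        + of_real (g2\<^sup>2 * (g2 - 1)) * (tcoeff f 2)\<^sup>2"
    using class_C_coeffs[OF g f phi0] unfolding g2 g3 B1 B2 by auto
  define m where "m = g2 - 1"
  have m: "m \<noteq> 0" using nondegenerate by (simp add: m_def)
  define t where "t = 1 - 2 * \<iota>"
  define G3 where "G3 = g3 * (g3 - 1)"
  \<comment> \<open>\<open>-K\<close> is the slope of \<open>t\<close> as an affine function of \<open>\<mu>\<close>.\<close>
  define K where "K = B1 * G3 / (g2\<^sup>2 * m\<^sup>2)"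
  have G3: "G3 > 0" using nondegenerate by (simp add: G3_def)
  have K: "K > 0"
    using B1_pos G3 m nondegenerate by (simp add: K_def)
  have t: "t = B2 / B1 + B1 / m - K * \<mu>"
    using m nondegenerate B1_pos unfolding t_def iota K_def G3_def[symmetric] m_def[symmetric]
    by (simp add: field_simps power2_eq_square)
  \<comment> \<open>By \<open>t\<close>, multiplication by \<open>K\<close> turns the two thresholds into the values \<open>1\<close> and \<open>-1\<close> of \<open>t\<close>.\<close>
  have i1: "K * \<iota>1 = B2 / B1 + B1 / m - 1" and i2: "K * \<iota>2 = B2 / B1 + B1 / m + 1"
  proof -
    have denom: "B1\<^sup>2 * g3 * (g3 - 1) = B1\<^sup>2 * G3" by (simp add: G3_def)
    have "K * ((B1\<^sup>2 * g2\<^sup>2 * m + s * g2\<^sup>2 * m\<^sup>2) / (B1\<^sup>2 * G3))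
        = B1 / m + s / B1" for s
      unfolding K_def using m nondegenerate(1) B1_pos G3
      by (simp add: divide_simps) (simp add: algebra_simps power2_eq_square)
    from this[of "B2 - B1"] this[of "B2 + B1"]
    show "K * \<iota>1 = B2 / B1 + B1 / m - 1" "K * \<iota>2 = B2 / B1 + B1 / m + 1"
      unfolding iota1 iota2 denom m_def[symmetric] using B1_pos by (simp_all add: add_divide_distrib diff_divide_distrib)
  qed
  have \<mu>1: "\<mu> \<le> \<iota>1 \<longleftrightarrow> t \<ge> 1"
    using mult_le_cancel_left_pos[OF K, of \<mu> \<iota>1] unfolding t i1 by linarith
  have \<mu>1': "\<iota>1 \<le> \<mu> \<longleftrightarrow> t \<le> 1"
    using mult_le_cancel_left_pos[OF K, of \<iota>1 \<mu>] unfolding t i1 by linarith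
  have \<mu>2: "\<mu> \<le> \<iota>2 \<longleftrightarrow> t \<ge> -1"
    using mult_le_cancel_left_pos[OF K, of \<mu> \<iota>2] unfolding t i2 by linarith
  have \<mu>2': "\<iota>2 \<le> \<mu> \<longleftrightarrow> t \<le> -1"
    using mult_le_cancel_left_pos[OF K, of \<iota>2 \<mu>] unfolding t i2 by linarith
  define c where "c = B1 / (g2 * m)"
  have a2: "tcoeff f 2 = of_real c * tcoeff u 1"
    unfolding c_def using c1 m nondegenerate(1) unfolding m_def[symmetric] by (simp add: field_simps)
  have a3: "tcoeff f 3 = (of_real B1 * tcoeff u 2 + of_real B2 * (tcoeff u 1)\<^sup>2
        + of_real (g2\<^sup>2 * m) * (tcoeff f 2)\<^sup>2) / of_real G3"
    using c2 G3 unfolding G3_def[symmetric] m_def[symmetric] by (simp add: field_simps)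
  have coeff: "B1 / G3 * t = (B2 + g2\<^sup>2 * m * c\<^sup>2) / G3
      - \<mu> * c\<^sup>2"
    unfolding t K_def c_def using m nondegenerate(1) B1_pos G3
    by (simp add: divide_simps) (simp add: algebra_simps power2_eq_square)
  have "tcoeff f 3 - of_real \<mu> * (tcoeff f 2)\<^sup>2
      = of_real (B1 / G3) * tcoeff u 2 + of_real (B1 / G3 * t) * (tcoeff u 1)\<^sup>2"
    unfolding coeff a3 a2 by (simp add: power_mult_distrib add_divide_distrib algebra_simps)
  also have "\<dots> = of_real (B1 / G3) * (tcoeff u 2 + of_real t * (tcoeff u 1)\<^sup>2)"
    by (simp add: algebra_simps)
  finally have "norm (tcoeff f 3 - of_real \<mu> * (tcoeff f 2)\<^sup>2)
      = B1 / G3 * norm (tcoeff u 2 + of_real t * (tcoeff u 1)\<^sup>2)"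
    using B1_pos G3 by (simp add: norm_mult norm_divide)
  also have "\<dots> \<le> B1 / G3 * max 1 \<bar>t\<bar>"
    using schwarz_function_fekete_szego[OF u] B1_pos G3 by (intro mult_left_mono) auto
  finally have main: "norm (tcoeff f 3 - of_real \<mu> * (tcoeff f 2)\<^sup>2) \<le> B1 / G3 * max 1 \<bar>t\<bar>" .
  have "max 1 \<bar>t\<bar> = - 2 * \<iota> + 1" if "t \<ge> 1" using that by (simp add: t_def)
  moreover have "max 1 \<bar>t\<bar> = 1" if "t \<le> 1" "t \<ge> -1" using that by simp
  moreover have "max 1 \<bar>t\<bar> = 2 * \<iota> - 1" if "t \<le> -1" using that by (simp add: t_def)
  ultimately show ?thesis
    using main unfolding \<mu>1 \<mu>1' \<mu>2 \<mu>2' G3_def by metis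
qed

end
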